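(* Let $I\subset\mathbb R$ be an interval, let $(\gamma_h,\gamma_h^d):I\to\Delta_1$ be a spacelike Legendre curve with curvature $(m_h,n_h)$ and $\gamma_h^s=\gamma_h\wedge\gamma_h^d$, and for a choice of sign let $\mathcal{HI}^\pm_{s_\pm}=\gamma_h+s_\pm\gamma_h^s+\frac{s_\pm^2}{2}(\gamma_h\pm\gamma_h^d)$ be a hyperbolic horocyclic involute of $(\gamma_h,\gamma_h^d)$, where $s_\pm$ is a solution of $\dot s_\pm=\frac{m_h\pm n_h}{2}s_\pm^2-m_h$. Let $\nu^\pm_{\mathcal{HI}}=-s_\pm\gamma_h-\gamma_h^s\mp s_\pm\gamma_h^d$ and $\mu^\pm_{\mathcal{HI}}=\mathcal{HI}^\pm_{s_\pm}\wedge\nu^\pm_{\mathcal{HI}}$. Then $$(\mathcal{HI}^\pm_{s_\pm},\nu^\pm_{\mathcal{HI}},\mu^\pm_{\mathcal{HI}})^T=N_2^\mp(-s_\pm)\,R(\pi/2)\,(\gamma_h,\gamma_h^d,\gamma_h^s)^T .$$ That is, $(\mathcal{HI}^\pm_{s_\pm}(t),\nu^\pm_{\mathcal{HI}}(t),\mu^\pm_{\mathcal{HI}}(t))$ is obtained by applying a rotation with angle $\pi/2$ to $(\gamma_h(t),\gamma_h^d(t),\gamma_h^s(t))$, followed by a null rotation around the $(\gamma_h\mp\gamma_h^d)$-direction with angle $-s_\pm(t)$, for all $t\in I$.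
   Context: All maps are $C^\infty$. $\mathbb R^3_1$ is $\mathbb R^3$ with $\langle x,y\rangle=-x_1y_1+x_2y_2+x_3y_3$ and $x\wedge y=(-(x_2y_3-x_3y_2),\,x_3y_1-x_1y_3,\,x_1y_2-x_2y_1)$. $H^2=\{x:\langle x,x\rangle=-1\}$, $S^2_1=\{x:\langle x,x\rangle=1\}$, $\Delta_1=\{(v,w)\in H^2\times S_1^2:\langle v,w\rangle=0\}$. A spacelike Legendre curve in $\Delta_1$ is a smooth map $(\gamma_h,\gamma_h^d):I\to\Delta_1$ with $\langle\dot\gamma_h,\gamma_h^d\rangle=0$ on $I$. Its curvature $(m_h,n_h)$ is defined by $\dot\gamma_h=m_h\gamma_h^s$, $\dot\gamma_h^d=n_h\gamma_h^s$, $\dot\gamma_h^s=m_h\gamma_h-n_h\gamma_h^d$ with $\gamma_h^s=\gamma_h\wedge\gamma_h^d$. If the solution $s_\pm$ is not global, $I$ is replaced by a subinterval on which it exists. Matrices: $R(\phi)=\begin{pmatrix}1&0&0\\0&\cos\phi&-\sin\phi\\0&\sin\phi&\cos\phi\end{pmatrix}$, $N_2^\pm(\phi)=\begin{pmatrix}1+\frac{\phi^2}{2}&\phi&\mp\frac{\phi^2}{2}\\ \phi&1&\mp\phi\\ \pm\frac{\phi^2}{2}&\pm\phi&1-\frac{\phi^2}{2}\end{pmatrix}$. With respect to a pseudo-orthonormal basis $(x_1,x_2,x_3)$ with $x_1$ timelike, $R(\phi)$ is called the matrix of the rotation with angle $\phi$, and $N_2^\pm(\phi)$ the matrix of the null rotation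 around the $(x_1\pm x_3)$-direction with angle $\phi$. For a $3\times3$ matrix $A=(a_{ij})$ and vectors $v_1,v_2,v_3$, $A(v_1,v_2,v_3)^T$ denotes the triple whose $i$-th entry is $\sum_j a_{ij}v_j$. Upper signs go together and lower signs go together. *)

theory Defs
  imports "HOL-Analysis.Analysis"
begin

definition mink :: "real^3 \<Rightarrow> real^3 \<Rightarrow> real" where
  "mink x y = - (x$1 * y$1) + x$2 * y$2 + x$3 * y$3"

definition wedge :: "real^3 \<Rightarrow> real^3 \<Rightarrow> real^3" where
  "wedge x y = vector [- (x$2 * y$3 - x$3 * y$2), x$3 * y$1 - x$1 * y$3, x$1 * y$2 - x$2 * y$1]"

definition H2 :: "(real^3) set" where
  "H2 = {x. mink x x = -1}"

definition S21 :: "(real^3) set" where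
  "S21 = {x. mink x x = 1}"

definition Delta1 :: "((real^3) \<times> (real^3)) set" where
  "Delta1 = {(v, w). v \<in> H2 \<and> w \<in> S21 \<and> mink v w = 0}"

(* C-infinity on an interval: an infinite sequence of successive derivatives exists,
   one-sided at those endpoints that belong to the interval. *)
definition smooth_on :: "real set \<Rightarrow> (real \<Rightarrow> 'a::real_normed_vector) \<Rightarrow> bool" where
  "smooth_on I f \<longleftrightarrow> (\<exists>D :: nat \<Rightarrow> real \<Rightarrow> 'a. D 0 = f \<and>
     (\<forall>n. \<forall>t\<in>I. (D n has_vector_derivative D (Suc n) t) (at t within I)))"

definition spacelike_legendre_curve ::
    "real set \<Rightarrow> (real \<Rightarrow> real^3) \<Rightarrow> (real \<Rightarrow> real^3) \<Rightarrow> bool" where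
  "spacelike_legendre_curve I \<gamma> \<gamma>d \<longleftrightarrow>
     smooth_on I \<gamma> \<and> smooth_on I \<gamma>d \<and>
     (\<forall>t\<in>I. (\<gamma> t, \<gamma>d t) \<in> Delta1) \<and>
     (\<forall>t\<in>I. mink (vector_derivative \<gamma> (at t within I)) (\<gamma>d t) = 0)"

definition frame_s :: "(real \<Rightarrow> real^3) \<Rightarrow> (real \<Rightarrow> real^3) \<Rightarrow> real \<Rightarrow> real^3" where
  "frame_s \<gamma> \<gamma>d t = wedge (\<gamma> t) (\<gamma>d t)"

definition has_legendre_curvature ::
    "real set \<Rightarrow> (real \<Rightarrow> real^3) \<Rightarrow> (real \<Rightarrow> real^3) \<Rightarrow> (real \<Rightarrow> real) \<Rightarrow> (real \<Rightarrow> real) \<Rightarrow> bool" where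
  "has_legendre_curvature I \<gamma> \<gamma>d m n \<longleftrightarrow> (\<forall>t\<in>I.
     (\<gamma> has_vector_derivative m t *\<^sub>R frame_s \<gamma> \<gamma>d t) (at t within I) \<and>
     (\<gamma>d has_vector_derivative n t *\<^sub>R frame_s \<gamma> \<gamma>d t) (at t within I) \<and>
     (frame_s \<gamma> \<gamma>d has_vector_derivative m t *\<^sub>R \<gamma> t - n t *\<^sub>R \<gamma>d t) (at t within I))"

(* Throughout, \<epsilon> = 1 stands for the upper and \<epsilon> = -1 for the lower signs. *)

definition horocyclic_parameter ::
    "real \<Rightarrow> real set \<Rightarrow> (real \<Rightarrow> real) \<Rightarrow> (real \<Rightarrow> real) \<Rightarrow> (real \<Rightarrow> real) \<Rightarrow> bool" where
  "horocyclic_parameter \<epsilon> I m n s \<longleftrightarrow> smooth_on I s \<and>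
     (\<forall>t\<in>I. (s has_real_derivative (m t + \<epsilon> * n t) / 2 * (s t)^2 - m t) (at t within I))"

definition horocyclic_involute ::
    "real \<Rightarrow> (real \<Rightarrow> real^3) \<Rightarrow> (real \<Rightarrow> real^3) \<Rightarrow> (real \<Rightarrow> real) \<Rightarrow> real \<Rightarrow> real^3" where
  "horocyclic_involute \<epsilon> \<gamma> \<gamma>d s t =
     \<gamma> t + s t *\<^sub>R frame_s \<gamma> \<gamma>d t + ((s t)^2 / 2) *\<^sub>R (\<gamma> t + \<epsilon> *\<^sub>R \<gamma>d t)"

definition involute_nu ::
    "real \<Rightarrow> (real \<Rightarrow> real^3) \<Rightarrow> (real \<Rightarrow> real^3) \<Rightarrow> (real \<Rightarrow> real) \<Rightarrow> real \<Rightarrow> real^3" where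
  "involute_nu \<epsilon> \<gamma> \<gamma>d s t =
     - (s t *\<^sub>R \<gamma> t) - frame_s \<gamma> \<gamma>d t - (\<epsilon> * s t) *\<^sub>R \<gamma>d t"

definition involute_mu ::
    "real \<Rightarrow> (real \<Rightarrow> real^3) \<Rightarrow> (real \<Rightarrow> real^3) \<Rightarrow> (real \<Rightarrow> real) \<Rightarrow> real \<Rightarrow> real^3" where
  "involute_mu \<epsilon> \<gamma> \<gamma>d s t =
     wedge (horocyclic_involute \<epsilon> \<gamma> \<gamma>d s t) (involute_nu \<epsilon> \<gamma> \<gamma>d s t)"

definition rot_matrix :: "real \<Rightarrow> real^3^3" where
  "rot_matrix \<phi> = vector [
     vector [1, 0, 0],
     vector [0, cos \<phi>, - sin \<phi>],
     vector [0, sin \<phi>, cos \<phi>]]"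

definition null_rot_matrix :: "real \<Rightarrow> real \<Rightarrow> real^3^3" where
  "null_rot_matrix \<epsilon> \<phi> = vector [
     vector [1 + \<phi>^2 / 2, \<phi>, - \<epsilon> * (\<phi>^2 / 2)],
     vector [\<phi>, 1, - \<epsilon> * \<phi>],
     vector [\<epsilon> * (\<phi>^2 / 2), \<epsilon> * \<phi>, 1 - \<phi>^2 / 2]]"

(* A triple of vectors is an element of (real^3)^3; the matrix combines the entries of the
   triple, it does not act on the coordinates of each entry. *)
definition triple_mult :: "real^3^3 \<Rightarrow> (real^3)^3 \<Rightarrow> (real^3)^3" where
  "triple_mult A V = (\<chi> i. \<Sum>j\<in>UNIV. A$i$j *\<^sub>R V$j)"

(* Three such vectors automatically form a basis of real^3. *)
definition pseudo_orthonormal_basis :: "(real^3)^3 \<Rightarrow> bool" where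
  "pseudo_orthonormal_basis X \<longleftrightarrow>
     (\<forall>i j. mink (X$i) (X$j) = (if i = j then (if i = 1 then -1 else 1) else 0))"

definition rotated_by :: "real \<Rightarrow> (real^3)^3 \<Rightarrow> (real^3)^3 \<Rightarrow> bool" where
  "rotated_by \<phi> X Y \<longleftrightarrow> pseudo_orthonormal_basis X \<and> Y = triple_mult (rot_matrix \<phi>) X"

(* The axis x1 + \<epsilon> x3 attached to null_rot_matrix \<epsilon> is that of the matrix acting on coordinate
   columns, where (1, 0, \<epsilon>) is fixed. On triples of vectors (via triple_mult) the combination
   left unchanged is the one with -\<epsilon>. *)
definition null_rotated_by :: "real^3 \<Rightarrow> real \<Rightarrow> (real^3)^3 \<Rightarrow> (real^3)^3 \<Rightarrow> bool" where
  "null_rotated_by l \<phi> X Y \<longleftrightarrow> pseudo_orthonormal_basis X \<and>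
     (\<exists>\<epsilon>\<in>{1, -1}. l = X$1 + \<epsilon> *\<^sub>R X$3 \<and> Y = triple_mult (null_rot_matrix \<epsilon> \<phi>) X)"

end

theory Submission
  imports Defs
begin

text \<open>
  The statement is pointwise algebra. At each parameter, \<open>(\<gamma>, \<gamma>\<^sup>d) \<in> \<Delta>\<^sub>1\<close> makes \<open>(\<gamma>, \<gamma>\<^sup>d, \<gamma>\<^sup>s)\<close> a
  pseudo-orthonormal basis, in which \<open>HI\<close> and \<open>\<nu>\<close> are given by their coefficients. What has to be
  computed is the expansion of \<open>\<mu> = HI \<and> \<nu>\<close> in this basis.

  The double wedge product formula (lemma \<open>wedge_wedge\<close>) gives the multiplication table
  \<open>\<gamma> \<and> \<gamma>\<^sup>d = \<gamma>\<^sup>s\<close>, \<open>\<gamma> \<and> \<gamma>\<^sup>s = -\<gamma>\<^sup>d\<close>, \<open>\<gamma>\<^sup>d \<and> \<gamma>\<^sup>s = -\<gamma>\<close>. As the wedge product is bilinear and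
  alternating, \<open>HI \<and> \<nu>\<close> is determined by the three \<open>2 \<times> 2\<close> minors of the coefficients of \<open>HI\<close> and
  \<open>\<nu>\<close> (lemma \<open>wedge_in_frame\<close>), which yields
  \<open>\<mu> = -\<epsilon> (s\<^sup>2 / 2) \<gamma> + (1 - s\<^sup>2 / 2) \<gamma>\<^sup>d - \<epsilon> s \<gamma>\<^sup>s\<close>.

  On the other side, a quarter turn takes the frame to \<open>(\<gamma>, -\<gamma>\<^sup>s, \<gamma>\<^sup>d)\<close>, so \<open>\<gamma>\<^sup>d\<close> moves into the
  third position. The vector \<open>x\<^sub>1 - \<epsilon> x\<^sub>3\<close> of the rotated frame is therefore \<open>\<gamma> - \<epsilon> \<gamma>\<^sup>d\<close>, the required
  direction, and the rows of the null rotation matrix applied to the rotated frame are exactly the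
  expansions of \<open>HI\<close>, \<open>\<nu>\<close> and \<open>\<mu>\<close>.
\<close>

section \<open>Triples of vectors\<close>

lemma triple_mult_matrix_mult:
  "triple_mult (A ** B) X = triple_mult A (triple_mult B X)"
proof -
  have "(\<Sum>j\<in>UNIV. (\<Sum>k\<in>UNIV. A$i$k * B$k$j) *\<^sub>R X$j) =
        (\<Sum>k\<in>UNIV. A$i$k *\<^sub>R (\<Sum>j\<in>UNIV. B$k$j *\<^sub>R X$j))" for i
    unfolding scaleR_sum_left scaleR_sum_right
    by (subst sum.swap) simp
  then show ?thesis
    by (simp add: triple_mult_def matrix_matrix_mult_def)
qed

lemma triple_mult_rot_matrix_quarter_turn:
  "triple_mult (rot_matrix (pi / 2)) (vector [x, y, z]) = vector [x, - z, y]"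
  by (simp add: triple_mult_def rot_matrix_def vec_eq_iff forall_3 sum_3)

lemma triple_mult_null_rot_matrix:
  "triple_mult (null_rot_matrix \<epsilon> \<phi>) (vector [x, y, z]) = vector [
     (1 + \<phi>\<^sup>2 / 2) *\<^sub>R x + \<phi> *\<^sub>R y - (\<epsilon> * (\<phi>\<^sup>2 / 2)) *\<^sub>R z,
     \<phi> *\<^sub>R x + y - (\<epsilon> * \<phi>) *\<^sub>R z,
     (\<epsilon> * (\<phi>\<^sup>2 / 2)) *\<^sub>R x + (\<epsilon> * \<phi>) *\<^sub>R y + (1 - \<phi>\<^sup>2 / 2) *\<^sub>R z]"
  by (simp add: triple_mult_def null_rot_matrix_def vec_eq_iff forall_3 sum_3)

section \<open>The Minkowski wedge product\<close>

lemma mink_commute: "mink x y = mink y x"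
  by (simp add: mink_def)

lemma mink_minus_left [simp]: "mink (- x) y = - mink x y"
  by (simp add: mink_def)

lemma mink_minus_right [simp]: "mink x (- y) = - mink x y"
  by (simp add: mink_def)

lemma mink_wedge_left [simp]: "mink x (wedge x y) = 0"
  by (simp add: mink_def wedge_def algebra_simps)

lemma mink_wedge_right [simp]: "mink y (wedge x y) = 0"
  by (simp add: mink_def wedge_def algebra_simps)

text \<open>
  The Lagrange identity. Its right-hand side is the negative of the Euclidean one, because the
  cofactor matrix of the metric \<open>diag(-1, 1, 1)\<close> is the negative of the metric. This makes the wedge
  product of orthogonal timelike and spacelike unit vectors a spacelike unit vector.
\<close>

lemma mink_wedge_wedge:
  "mink (wedge x y) (wedge x y) = (mink x y)\<^sup>2 - mink x x * mink y y"
  by (simp add: mink_def wedge_def power2_eq_square algebra_simps)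

lemma wedge_wedge: "wedge x (wedge y z) = mink x y *\<^sub>R z - mink x z *\<^sub>R y"
  by (simp add: mink_def wedge_def vec_eq_iff forall_3 algebra_simps)

lemma wedge_linear_combinations:
  "wedge (a *\<^sub>R x + b *\<^sub>R y + c *\<^sub>R z) (a' *\<^sub>R x + b' *\<^sub>R y + c' *\<^sub>R z) =
     (a * b' - b * a') *\<^sub>R wedge x y + (a * c' - c * a') *\<^sub>R wedge x z + (b * c' - c * b') *\<^sub>R wedge y z"
  by (simp add: wedge_def vec_eq_iff forall_3 algebra_simps)

section \<open>The frame of a point of \<open>\<Delta>\<^sub>1\<close>\<close>

lemma Delta1_iff: "(v, w) \<in> Delta1 \<longleftrightarrow> mink v v = -1 \<and> mink w w = 1 \<and> mink v w = 0"
  by (simp add: Delta1_def H2_def S21_def)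

lemma pseudo_orthonormal_basis_Delta1:
  assumes "(v, w) \<in> Delta1"
  shows "pseudo_orthonormal_basis (vector [v, w, wedge v w])"
  using assms mink_commute[of w v] mink_commute[of "wedge v w"]
  by (simp add: pseudo_orthonormal_basis_def forall_3 Delta1_iff mink_wedge_wedge)

lemma pseudo_orthonormal_basis_quarter_turn:
  assumes "pseudo_orthonormal_basis (vector [x, y, z])"
  shows "pseudo_orthonormal_basis (vector [x, - z, y])"
  using assms by (simp add: pseudo_orthonormal_basis_def forall_3)

lemma wedge_in_frame:
  assumes "(v, w) \<in> Delta1"
  defines "u \<equiv> wedge v w"
  shows "wedge (a *\<^sub>R v + b *\<^sub>R w + c *\<^sub>R u) (a' *\<^sub>R v + b' *\<^sub>R w + c' *\<^sub>R u) =
     (c * b' - b * c') *\<^sub>R v + (c * a' - a * c') *\<^sub>R w + (a * b' - b * a') *\<^sub>R u"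
proof -
  have "wedge v u = - w" "wedge w u = - v"
    using assms mink_commute[of w v] by (simp_all add: wedge_wedge Delta1_iff)
  then show ?thesis
    unfolding wedge_linear_combinations by (simp add: u_def[symmetric] algebra_simps)
qed

section \<open>The frame of the horocyclic involute\<close>

lemma horocyclic_involute_expansion:
  "horocyclic_involute \<epsilon> \<gamma> \<gamma>d s t =
     (1 + (s t)\<^sup>2 / 2) *\<^sub>R \<gamma> t + (\<epsilon> * ((s t)\<^sup>2 / 2)) *\<^sub>R \<gamma>d t + s t *\<^sub>R frame_s \<gamma> \<gamma>d t"
  by (simp add: horocyclic_involute_def algebra_simps)

lemma involute_nu_expansion:
  "involute_nu \<epsilon> \<gamma> \<gamma>d s t =
     (- s t) *\<^sub>R \<gamma> t + (- (\<epsilon> * s t)) *\<^sub>R \<gamma>d t + (-1) *\<^sub>R frame_s \<gamma> \<gamma>d t"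
  by (simp add: involute_nu_def)

text \<open>
  Each coefficient is a minor of the two expansions above; the cubic terms of the minor belonging to
  \<open>\<gamma>\<^sup>s\<close> cancel.
\<close>

lemma involute_mu_expansion:
  assumes "(\<gamma> t, \<gamma>d t) \<in> Delta1"
  shows "involute_mu \<epsilon> \<gamma> \<gamma>d s t =
     (- (\<epsilon> * ((s t)\<^sup>2 / 2))) *\<^sub>R \<gamma> t + (1 - (s t)\<^sup>2 / 2) *\<^sub>R \<gamma>d t + (- (\<epsilon> * s t)) *\<^sub>R frame_s \<gamma> \<gamma>d t"
proof -
  let ?s = "s t"
  have gamma: "?s * (- (\<epsilon> * ?s)) - \<epsilon> * (?s\<^sup>2 / 2) * (-1) = - (\<epsilon> * (?s\<^sup>2 / 2))"
    and gamma_d: "?s * (- ?s) - (1 + ?s\<^sup>2 / 2) * (-1) = 1 - ?s\<^sup>2 / 2"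
    and gamma_s: "(1 + ?s\<^sup>2 / 2) * (- (\<epsilon> * ?s)) - \<epsilon> * (?s\<^sup>2 / 2) * (- ?s) = - (\<epsilon> * ?s)"
    by (simp_all add: power2_eq_square algebra_simps)
  show ?thesis
    unfolding involute_mu_def horocyclic_involute_expansion involute_nu_expansion
    unfolding frame_s_def wedge_in_frame[OF assms] gamma gamma_d gamma_s ..
qed

lemma involute_frame_eq_null_rotation:
  assumes "(\<gamma> t, \<gamma>d t) \<in> Delta1"
  shows "vector [horocyclic_involute \<epsilon> \<gamma> \<gamma>d s t, involute_nu \<epsilon> \<gamma> \<gamma>d s t, involute_mu \<epsilon> \<gamma> \<gamma>d s t] =
     triple_mult (null_rot_matrix (- \<epsilon>) (- s t)) (vector [\<gamma> t, - frame_s \<gamma> \<gamma>d t, \<gamma>d t])"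
  unfolding triple_mult_null_rot_matrix horocyclic_involute_expansion involute_nu_expansion
    involute_mu_expansion[of \<gamma> t \<gamma>d, OF assms]
  by (simp add: algebra_simps)

theorem proposition3p17:
  fixes I :: "real set"
    and \<gamma> \<gamma>d :: "real \<Rightarrow> real^3"
    and m n s :: "real \<Rightarrow> real"
    and \<epsilon> :: real
  assumes "is_interval I"
    and "spacelike_legendre_curve I \<gamma> \<gamma>d"
    and "has_legendre_curvature I \<gamma> \<gamma>d m n"
    and "\<epsilon> \<in> {1, -1}"
    and "horocyclic_parameter \<epsilon> I m n s"
  shows "\<forall>t\<in>I.
     (vector [horocyclic_involute \<epsilon> \<gamma> \<gamma>d s t, involute_nu \<epsilon> \<gamma> \<gamma>d s t, involute_mu \<epsilon> \<gamma> \<gamma>d s t] :: (real^3)^3) =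
       triple_mult (null_rot_matrix (- \<epsilon>) (- s t) ** rot_matrix (pi / 2))
         (vector [\<gamma> t, \<gamma>d t, frame_s \<gamma> \<gamma>d t]) \<and>
     (\<exists>F. rotated_by (pi / 2) (vector [\<gamma> t, \<gamma>d t, frame_s \<gamma> \<gamma>d t]) F \<and>
          null_rotated_by (\<gamma> t - \<epsilon> *\<^sub>R \<gamma>d t) (- s t) F
            (vector [horocyclic_involute \<epsilon> \<gamma> \<gamma>d s t, involute_nu \<epsilon> \<gamma> \<gamma>d s t, involute_mu \<epsilon> \<gamma> \<gamma>d s t]))"
proof
  fix t
  assume t: "t \<in> I"
  let ?X = "vector [\<gamma> t, \<gamma>d t, frame_s \<gamma> \<gamma>d t] :: (real^3)^3"
  let ?F = "vector [\<gamma> t, - frame_s \<gamma> \<gamma>d t, \<gamma>d t] :: (real^3)^3"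
  let ?Y = "vector [horocyclic_involute \<epsilon> \<gamma> \<gamma>d s t, involute_nu \<epsilon> \<gamma> \<gamma>d s t,
    involute_mu \<epsilon> \<gamma> \<gamma>d s t] :: (real^3)^3"
  have Delta1: "(\<gamma> t, \<gamma>d t) \<in> Delta1"
    using assms t by (simp add: spacelike_legendre_curve_def)
  have X: "pseudo_orthonormal_basis ?X"
    unfolding frame_s_def by (rule pseudo_orthonormal_basis_Delta1[OF Delta1])
  have F: "triple_mult (rot_matrix (pi / 2)) ?X = ?F"
    by (rule triple_mult_rot_matrix_quarter_turn)
  have Y: "?Y = triple_mult (null_rot_matrix (- \<epsilon>) (- s t)) ?F"
    by (rule involute_frame_eq_null_rotation[of \<gamma> t \<gamma>d, OF Delta1])
  have "?Y = triple_mult (null_rot_matrix (- \<epsilon>) (- s t) ** rot_matrix (pi / 2)) ?X"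
    unfolding triple_mult_matrix_mult F by (rule Y)
  moreover have "rotated_by (pi / 2) ?X ?F"
    using X F by (simp add: rotated_by_def)
  moreover have "null_rotated_by (\<gamma> t - \<epsilon> *\<^sub>R \<gamma>d t) (- s t) ?F ?Y"
    unfolding null_rotated_by_def
  proof (intro conjI bexI)
    show "pseudo_orthonormal_basis ?F"
      by (rule pseudo_orthonormal_basis_quarter_turn[OF X])
    show "\<gamma> t - \<epsilon> *\<^sub>R \<gamma>d t = ?F $ 1 + (- \<epsilon>) *\<^sub>R ?F $ 3"
      by simp
    show "- \<epsilon> \<in> {1, -1}"
      using assms by auto
  qed (rule Y)
  ultimately show "?Y = triple_mult (null_rot_matrix (- \<epsilon>) (- s t) ** rot_matrix (pi / 2)) ?X \<and>
      (\<exists>F. rotated_by (pi / 2) ?X F \<and> null_rotated_by (\<gamma> t - \<epsilon> *\<^sub>R \<gamma>d t) (- s t) F ?Y)"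
    by blast
qed

end
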